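(* Let $s,t$ be indeterminates and define the generalized Lucas numbers $\{n\}\in\mathbb{Z}[s,t]$ by $\{0\}=0$, $\{1\}=1$ and $\{n\}=s\{n-1\}+t\{n-2\}$ for $n\ge 2$. Define the Lucas-Eulerian numbers $E_{\{n,k\}}$ (for integers $n\ge0$ and $k$) by the initial conditions $E_{\{n,0\}}=E_{\{n,n\}}=1$ for $n\ge0$, $E_{\{n,k\}}=0$ if $n<k$ or $k<0$, and the recursion $$E_{\{n,k\}}=\{k+1\}E_{\{n-1,k\}}+\{n-k+1\}E_{\{n-1,k-1\}}\quad\text{for }0\le k\le n.$$ Then the Lucas-Eulerian numbers are palindromic: $E_{\{n,k\}}=E_{\{n,n-k\}}$ for all integers $0\le k\le n$.
   Context: $s$ and $t$ are independent indeterminates; the $E_{\{n,k\}}$ are polynomials in $s,t$ with nonnegative integer coefficients. *)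

theory Defs
  imports "HOL-Computational_Algebra.Polynomial"
begin

text \<open>
  The ring \<open>\<int>[s,t]\<close> is represented as \<open>(\<int>[s])[t]\<close>, that is, as the type \<^typ>\<open>int poly poly\<close>:
  the inner polynomial variable is \<open>s\<close> and the outer one is \<open>t\<close>.
\<close>

definition indet_s :: "int poly poly" where
  "indet_s = [:[:0, 1:]:]"

definition indet_t :: "int poly poly" where
  "indet_t = [:0, 1:]"

fun lucas :: "nat \<Rightarrow> int poly poly" where
  "lucas 0 = 0"
| "lucas (Suc 0) = 1"
| "lucas (Suc (Suc n)) = indet_s * lucas (Suc n) + indet_t * lucas n"

text \<open>
  The second index ranges over all integers. The boundary values take precedence over the recursion;
  \<open>lucas_eulerian_rec\<close> below shows that the two agree where both apply. The recursion is meant for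
  \<open>n \<ge> 1\<close>, since it refers to row \<open>n - 1\<close>. The arguments of \<^const>\<open>nat\<close> are positive wherever
  the recursion is used.
\<close>

fun lucas_eulerian :: "nat \<Rightarrow> int \<Rightarrow> int poly poly" where
  "lucas_eulerian 0 k = (if k = 0 then 1 else 0)"
| "lucas_eulerian (Suc n) k =
    (if k < 0 \<or> int (Suc n) < k then 0
     else if k = 0 \<or> k = int (Suc n) then 1
     else lucas (nat (k + 1)) * lucas_eulerian n k
        + lucas (nat (int (Suc n) - k + 1)) * lucas_eulerian n (k - 1))"

lemma lucas_eulerian_left: "lucas_eulerian n 0 = 1"
  by (cases n) auto

lemma lucas_eulerian_right: "lucas_eulerian n (int n) = 1"
  by (cases n) auto

lemma lucas_eulerian_eq_0: "k < 0 \<or> int n < k \<Longrightarrow> lucas_eulerian n k = 0"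
  by (cases n) auto

lemma lucas_eulerian_rec:
  assumes "1 \<le> n" "0 \<le> k" "k \<le> int n"
  shows "lucas_eulerian n k =
    lucas (nat (k + 1)) * lucas_eulerian (n - 1) k
      + lucas (nat (int n - k + 1)) * lucas_eulerian (n - 1) (k - 1)"
proof -
  obtain m where n: "n = Suc m"
    using assms(1) by (cases n) auto
  consider "k = 0" | "k = int n" | "0 < k" "k < int n"
    using assms by linarith
  then show ?thesis
  proof cases
    case 1
    then show ?thesis
      by (simp add: lucas_eulerian_left lucas_eulerian_eq_0)
  next
    case 2
    have "lucas_eulerian n k = 1" "lucas_eulerian (n - 1) k = 0"
      using 2 n lucas_eulerian_right lucas_eulerian_eq_0 by auto
    moreover have "lucas_eulerian (n - 1) (k - 1) = 1"
      using 2 n lucas_eulerian_right[of m] by simp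
    moreover have "nat (int n - k + 1) = Suc 0"
      using 2 by simp
    ultimately show ?thesis by simp
  next
    case 3
    then show ?thesis by (simp add: n)
  qed
qed

end

theory Submission
  imports Defs
begin

text \<open>Under k -> n - k the weights {k+1} and {n-k+1} of the recursion trade places. By
  induction, row n - 1 is palindromic, which trades the two entries they multiply as well, so the
  reflection only swaps the two summands.\<close>

theorem theorem2:
  fixes n :: nat and k :: int
  assumes "0 \<le> k" and "k \<le> int n"
  shows "lucas_eulerian n k = lucas_eulerian n (int n - k)"
  using assms
proof (induction n arbitrary: k)
  case 0
  then show ?case by simp
next
  case (Suc n)
  show ?case
  \<comment> \<open>At the ends, \<open>k - 1\<close> or \<open>k\<close> leaves the range 0..n of
    the induction hypothesis; both values are 1 there.\<close>
  proof (cases "k = 0 \<or> k = int (Suc n)")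
    case True
    then show ?thesis
      using lucas_eulerian_left lucas_eulerian_right by auto
  next
    case False
    with Suc.prems have k: "0 < k" "k < int (Suc n)" by auto
    let ?m = "int (Suc n)"
    have "lucas_eulerian (Suc n) k =
        lucas (nat (k + 1)) * lucas_eulerian n k + lucas (nat (?m - k + 1)) * lucas_eulerian n (k - 1)"
      using lucas_eulerian_rec[of "Suc n" k] k by simp
    also have "lucas_eulerian n k = lucas_eulerian n (?m - k - 1)"
      using Suc.IH[of k] k by simp
    also have "lucas_eulerian n (k - 1) = lucas_eulerian n (?m - k)"
      using Suc.IH[of "k - 1"] k by (simp add: algebra_simps)
    \<comment> \<open>This is the recursion at column \<open>?m - k\<close> with its summands in the
      opposite order, since \<open>?m - (?m - k) + 1 = k + 1\<close>.\<close>
    also have "lucas (nat (k + 1)) * lucas_eulerian n (?m - k - 1)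
          + lucas (nat (?m - k + 1)) * lucas_eulerian n (?m - k) =
        lucas_eulerian (Suc n) (?m - k)"
      using lucas_eulerian_rec[of "Suc n" "?m - k"] k
      by (simp del: of_nat_Suc lucas_eulerian.simps)
    finally show ?thesis .
  qed
qed

end
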